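(* Let $b$ be a nonzero integer and suppose $0\in\chi(0,b)$. Let $p$ be an odd prime that is a $0$-PL prime relative to $(0,b)$. Then for every integer $q\geq 1$, the star graph $S_{q\pi_p(0,b)+1}$ is a $(0,b)$-FLC graph modulo $p$.
   Context: For integers $a,b$, the $(a,b)$-Fibonacci sequence is $F_0=a$, $F_1=b$, $F_n=F_{n-1}+F_{n-2}$ for $n\ge 2$. $(x/p)$ denotes the Legendre symbol for an odd prime $p$ (equal to $0$ when $p\mid x$). The $(a,b)$-Pisano period $\pi_p(a,b)$ is the smallest positive integer $t$ such that $F_{n+t}\equiv F_n \pmod p$ for all $n\ge 0$. For an odd prime $p$ and $j\in\{-1,0,1\}$, let $\Lambda_j^p(a,b)=\{\xi\in\{0,1,\ldots,\pi_p(a,b)-1\} : (F_\xi/p)=j\}$. The prime $p$ is a $k$-PL prime ($k$-Pisano-Legendre prime) relative to $(a,b)$ if $k=|\Lambda_1^p(a,b)|-|\Lambda_{-1}^p(a,b)|-|\Lambda_0^p(a,b)|$. The Pisano set $\chi(a,b)$ is the set of all integers $k$ for which there exists an odd prime $p$ that is a $k$-PL prime relative to $(a,b)$. Let $G$ be a simple connected graph of order (number of vertices) $n$. A bijection $f:V(G)\to\{0,1,\ldots,n-1\}$ is an $(a,b)$-FLC labeling (Fibonacci-Legendre cordial labeling) modulo $p$ if the induced edge labeling $f_p^*:E(G)\to\{0,1\}$, given by $f_p^*(uv)=\frac{1+([F_{f(u)}+F_{f(v)}]/p)}{2}$ if $F_{f(u)}+F_{f(v)}\not\equiv 0\pmod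 p$ and $f_p^*(uv)=0$ otherwise, satisfies $|e_{f_p^*}(0)-e_{f_p^*}(1)|\le 1$, where $e_{f_p^*}(i)$ is the number of edges labeled $i$. A graph admitting such a labeling is an $(a,b)$-FLC graph modulo $p$. The star graph $S_n$ has $n$ vertices $x_0,v_1,\ldots,v_{n-1}$ and edges $x_0v_i$ for $1\le i\le n-1$. *)

theory Defs
  imports "HOL-Number_Theory.Number_Theory"
begin

fun gfib :: "int \<Rightarrow> int \<Rightarrow> nat \<Rightarrow> int" where
  "gfib a b 0 = a"
| "gfib a b (Suc 0) = b"
| "gfib a b (Suc (Suc n)) = gfib a b (Suc n) + gfib a b n"

definition pisano_period :: "int \<Rightarrow> int \<Rightarrow> nat \<Rightarrow> nat" where
  "pisano_period a b p =
     (LEAST t. 0 < t \<and> (\<forall>n. [gfib a b (n + t) = gfib a b n] (mod int p)))"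

definition legendre_indices :: "int \<Rightarrow> int \<Rightarrow> nat \<Rightarrow> int \<Rightarrow> nat set" where
  "legendre_indices a b p j =
     {\<xi> \<in> {0..<pisano_period a b p}. Legendre (gfib a b \<xi>) (int p) = j}"

definition PL_prime :: "int \<Rightarrow> int \<Rightarrow> int \<Rightarrow> nat \<Rightarrow> bool" where
  "PL_prime k a b p \<longleftrightarrow> prime p \<and> odd p \<and>
     k = int (card (legendre_indices a b p 1))
         - int (card (legendre_indices a b p (- 1)))
         - int (card (legendre_indices a b p 0))"

definition pisano_set :: "int \<Rightarrow> int \<Rightarrow> int set" where
  "pisano_set a b = {k. \<exists>p. PL_prime k a b p}"

text \<open>Finite undirected graphs are pairs of a vertex set and a set of edges, where an edge is a
  two-element set of vertices; this excludes loops and multiple edges.\<close>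

type_synonym 'a ugraph = "'a set \<times> 'a set set"

definition simple_graph :: "'a ugraph \<Rightarrow> bool" where
  "simple_graph G \<longleftrightarrow> finite (fst G) \<and> (\<forall>e\<in>snd G. e \<subseteq> fst G \<and> card e = 2)"

definition connected_graph :: "'a ugraph \<Rightarrow> bool" where
  "connected_graph G \<longleftrightarrow> fst G \<noteq> {} \<and>
     (\<forall>u\<in>fst G. \<forall>v\<in>fst G. (u, v) \<in> {(x, y). {x, y} \<in> snd G}\<^sup>*)"

text \<open>For an edge \<open>e = {u, v}\<close> with \<open>u \<noteq> v\<close>, the sum below is
  \<open>F (f u) + F (f v)\<close>. The division by 2 is exact, since the Legendre symbol
  is 1 or -1 in that branch.\<close>

definition edge_label :: "int \<Rightarrow> int \<Rightarrow> nat \<Rightarrow> ('a \<Rightarrow> nat) \<Rightarrow> 'a set \<Rightarrow> int" where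
  "edge_label a b p f e =
     (let s = (\<Sum>w\<in>e. gfib a b (f w))
      in if [s = 0] (mod int p) then 0 else (1 + Legendre s (int p)) div 2)"

definition edge_count ::
    "int \<Rightarrow> int \<Rightarrow> nat \<Rightarrow> 'a ugraph \<Rightarrow> ('a \<Rightarrow> nat) \<Rightarrow> int \<Rightarrow> nat" where
  "edge_count a b p G f i = card {e \<in> snd G. edge_label a b p f e = i}"

definition FLC_labeling :: "int \<Rightarrow> int \<Rightarrow> nat \<Rightarrow> 'a ugraph \<Rightarrow> ('a \<Rightarrow> nat) \<Rightarrow> bool" where
  "FLC_labeling a b p G f \<longleftrightarrow>
     bij_betw f (fst G) {0..<card (fst G)} \<and>
     \<bar>int (edge_count a b p G f 0) - int (edge_count a b p G f 1)\<bar> \<le> 1"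

definition FLC_graph :: "int \<Rightarrow> int \<Rightarrow> nat \<Rightarrow> 'a ugraph \<Rightarrow> bool" where
  "FLC_graph a b p G \<longleftrightarrow>
     simple_graph G \<and> connected_graph G \<and> (\<exists>f. FLC_labeling a b p G f)"

text \<open>Vertex 0 is the centre \<open>x\<^sub>0\<close> and vertex \<open>i\<close>, for \<open>0 < i < n\<close>, is the leaf
  \<open>v\<^sub>i\<close>; the index \<open>n\<close> is the total number of vertices.\<close>

definition star_graph :: "nat \<Rightarrow> nat ugraph" where
  "star_graph n = ({0..<n}, {{0, i} | i. 1 \<le> i \<and> i \<le> n - 1})"

end

theory Submission imports Defs begin

text \<open>Label every vertex by itself, so that the centre receives \<open>F\<^sub>0 = 0\<close> and the edge to
  leaf \<open>i\<close> is labelled according to \<open>F\<^sub>i\<close> alone: by 1 if the Legendre symbol of \<open>F\<^sub>i\<close> is 1,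
  and by 0 otherwise. The leaves \<open>1, \<dots>, q\<pi>\<close> run through exactly \<open>q\<close> periods, and over one
  period the two labels are equally frequent because \<open>p\<close> is a 0-PL prime.\<close>

text \<open>Two consecutive residues determine all later ones, so the induction carries the
  congruences at \<open>n\<close> and \<open>Suc n\<close> together.\<close>

lemma gfib_cong_shift:
  assumes "[gfib a b s = gfib a b t] (mod m)"
    and "[gfib a b (Suc s) = gfib a b (Suc t)] (mod m)"
  shows "[gfib a b (n + s) = gfib a b (n + t)] (mod m)"
proof -
  have "[gfib a b (n + s) = gfib a b (n + t)] (mod m) \<and>
        [gfib a b (Suc (n + s)) = gfib a b (Suc (n + t))] (mod m)"
    by (induction n) (use assms in \<open>auto intro: cong_add\<close>)
  thus ?thesis by simp
qed

text \<open>The recurrence also runs backwards, as \<open>F n = F (n + 2) - F (n + 1)\<close>. Hence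
  a repetition anywhere reaches back to the start, and the sequence is periodic from index 0 rather
  than only eventually.\<close>

lemma gfib_cong_unshift:
  assumes "[gfib a b (n + s) = gfib a b (n + t)] (mod m)"
    and "[gfib a b (Suc (n + s)) = gfib a b (Suc (n + t))] (mod m)"
  shows "[gfib a b s = gfib a b t] (mod m) \<and>
         [gfib a b (Suc s) = gfib a b (Suc t)] (mod m)"
  using assms
proof (induction n)
  case (Suc n)
  have "[gfib a b (Suc (Suc (n + s))) - gfib a b (Suc (n + s))
       = gfib a b (Suc (Suc (n + t))) - gfib a b (Suc (n + t))] (mod m)"
    using Suc.prems by (intro cong_diff) simp_all
  hence "[gfib a b (n + s) = gfib a b (n + t)] (mod m)" by simp
  with Suc show ?case by simp
qed simp

text \<open>Pigeonhole: there are at most \<open>m * m\<close> pairs of consecutive residues, so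
  some pair recurs. Pulling the recurrence back to index 0 gives a period.\<close>

lemma gfib_periodic_mod:
  fixes m :: int
  assumes "m > 0"
  shows "\<exists>t>0. \<forall>n. [gfib a b (n + t) = gfib a b n] (mod m)"
proof -
  let ?r = "\<lambda>n. (gfib a b n mod m, gfib a b (Suc n) mod m)"
  have "range ?r \<subseteq> {0..<m} \<times> {0..<m}"
    using assms by auto
  hence "finite (range ?r)"
    by (rule finite_subset) simp
  hence "\<not> inj ?r"
    using finite_imageD by blast
  then obtain i j where "i < j" "?r i = ?r j"
    unfolding inj_def by (metis linorder_neq_iff)
  \<comment> \<open>The indices \<open>i\<close> and \<open>j\<close> are written with the common
    offset \<open>i\<close>, which is then stripped off.\<close>
  hence "[gfib a b (i + 0) = gfib a b (i + (j - i))] (mod m)"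
    "[gfib a b (Suc (i + 0)) = gfib a b (Suc (i + (j - i)))] (mod m)"
    by (auto simp: cong_def)
  from gfib_cong_unshift[OF this]
  have "[gfib a b (n + (j - i)) = gfib a b (n + 0)] (mod m)" for n
    by (intro gfib_cong_shift) (auto simp: cong_sym)
  with \<open>i < j\<close> show ?thesis
    by (intro exI[of _ "j - i"]) auto
qed

text \<open>The \<open>LEAST\<close> in the definition is meaningful only once some period exists,
  which the pigeonhole argument supplies.\<close>

lemma gfib_add_pisano_period:
  assumes "p > 0"
  shows "[gfib a b (n + pisano_period a b p) = gfib a b n] (mod int p)"
proof -
  have "\<exists>t. 0 < t \<and> (\<forall>n. [gfib a b (n + t) = gfib a b n] (mod int p))"
    using gfib_periodic_mod[of "int p" a b] assms by auto
  from LeastI_ex[OF this] show ?thesis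
    unfolding pisano_period_def by auto
qed

lemma Legendre_cong:
  assumes "[x = y] (mod p)"
  shows "Legendre x p = Legendre y p"
  using assms unfolding Legendre_def QuadRes_def by (simp add: cong_def)

lemma sum_lessThan_periodic:
  fixes g :: "nat \<Rightarrow> 'a::comm_semiring_1"
  assumes "\<And>n. g (n + t) = g n"
  shows "(\<Sum>i<q * t. g i) = of_nat q * (\<Sum>i<t. g i)"
proof -
  have period: "g (n + m * t) = g n" for n m
    by (induction m) (simp_all add: add.assoc[symmetric] assms add.commute[of t])
  have "(\<Sum>i<q * t. g i) = (\<Sum>m<q. \<Sum>i=m * t..<m * t + t. g i)"
    by (rule sum.nat_group[symmetric])
  also have "\<dots> = (\<Sum>m<q. \<Sum>i<t. g i)"
  proof (rule sum.cong[OF refl])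
    fix m
    have "(\<Sum>i=m * t..<m * t + t. g i) = (\<Sum>i=0..<t. g (i + m * t))"
      using sum.shift_bounds_nat_ivl[of g 0 "m * t" t] by (simp add: add.commute)
    thus "(\<Sum>i=m * t..<m * t + t. g i) = (\<Sum>i<t. g i)"
      by (simp add: period atLeast0LessThan)
  qed
  finally show ?thesis by simp
qed

text \<open>Moving the window from \<open>0, ..., q * t - 1\<close> to \<open>1, ..., q * t\<close>
  trades \<open>g 0\<close> for \<open>g (q * t)\<close>, which are equal. The shift is needed
  because leaves are numbered from 1.\<close>

lemma sum_atLeast1_periodic:
  fixes g :: "nat \<Rightarrow> 'a::comm_ring_1"
  assumes "\<And>n. g (n + t) = g n"
  shows "(\<Sum>i=1..q * t. g i) = of_nat q * (\<Sum>i<t. g i)"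
proof -
  have "g (m * t) = g 0" for m
    by (induction m) (simp_all add: assms add.commute[of t])
  hence "g 0 + (\<Sum>i=1..q * t. g i) = g 0 + (\<Sum>i<q * t. g i)"
    using sum.atLeast_Suc_atMost[of 0 "q * t" g] sum.lessThan_Suc[of g "q * t"]
    by (simp add: atMost_atLeast0 lessThan_Suc_atMost add.commute)
  thus ?thesis
    using sum_lessThan_periodic[of g t q] assms by simp
qed

lemma sum_sign_eq_card_diff:
  assumes "finite A"
  shows "(\<Sum>i\<in>A. if P i then 1 else - 1 :: int) =
    int (card {i \<in> A. P i}) - int (card {i \<in> A. \<not> P i})"
  using assms by (simp add: sum.If_cases Int_def)

text \<open>Symbols -1 and 0 both count negatively in \<open>k\<close>, so they merge into one class
  of weight -1. As a sum, \<open>k\<close> can be handled by the periodicity lemmas.\<close>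

lemma PL_prime_iff_sum:
  "PL_prime k a b p \<longleftrightarrow> prime p \<and> odd p \<and>
     k = (\<Sum>i<pisano_period a b p. if Legendre (gfib a b i) (int p) = 1 then 1 else - 1)"
proof -
  let ?T = "pisano_period a b p"
  let ?L = "\<lambda>i. Legendre (gfib a b i) (int p)"
  have "{i \<in> {..<?T}. ?L i \<noteq> 1} = legendre_indices a b p (- 1) \<union> legendre_indices a b p 0"
    by (auto simp: legendre_indices_def Legendre_def)
  moreover have "card (legendre_indices a b p (- 1) \<union> legendre_indices a b p 0) =
      card (legendre_indices a b p (- 1)) + card (legendre_indices a b p 0)"
    by (intro card_Un_disjoint) (auto simp: legendre_indices_def)
  moreover have "{i \<in> {..<?T}. ?L i = 1} = legendre_indices a b p 1"
    by (auto simp: legendre_indices_def)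
  ultimately have "(\<Sum>i<?T. if ?L i = 1 then 1 else - 1) =
      int (card (legendre_indices a b p 1)) - int (card (legendre_indices a b p (- 1)))
      - int (card (legendre_indices a b p 0))"
    using sum_sign_eq_card_diff[of "{..<?T}" "\<lambda>i. ?L i = 1"] by (simp only: finite_lessThan)
  thus ?thesis
    by (simp only: PL_prime_def)
qed

lemma simple_star_graph: "simple_graph (star_graph n)"
  by (auto simp: simple_graph_def star_graph_def)

lemma connected_star_graph:
  assumes "n > 0"
  shows "connected_graph (star_graph n)"
proof -
  let ?R = "{(x, y). {x, y} \<in> snd (star_graph n)}"
  have centre: "(0, v) \<in> ?R\<^sup>* \<and> (v, 0) \<in> ?R\<^sup>*" if "v < n" for v
  proof (cases "v = 0")
    case False
    with that have "{0, v} \<in> snd (star_graph n)"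
      by (auto simp: star_graph_def)
    hence "(0, v) \<in> ?R \<and> (v, 0) \<in> ?R"
      by (simp add: insert_commute)
    thus ?thesis by blast
  qed simp
  have "(u, v) \<in> ?R\<^sup>*" if "u < n" "v < n" for u v
    using centre[OF that(1)] centre[OF that(2)] by (meson rtrancl_trans)
  thus ?thesis
    using assms by (auto simp: connected_graph_def star_graph_def)
qed

text \<open>As \<open>a = 0\<close>, the centre contributes \<open>gfib 0 b 0 = 0\<close>. A zero
  residue has symbol 0 and label 0, and symbols 1 and -1 give labels 1 and 0.\<close>

lemma edge_label_star_id:
  assumes "i \<noteq> 0"
  shows "edge_label 0 b p (\<lambda>v. v) {0, i} =
    (if Legendre (gfib 0 b i) (int p) = 1 then 1 else 0)"
  using assms by (auto simp: edge_label_def Legendre_def)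

text \<open>Each edge is determined by its leaf, so counting edges becomes counting leaf
  indices.\<close>

lemma edge_count_star_id:
  "edge_count 0 b p (star_graph (Suc n)) (\<lambda>v. v) j =
    card {i \<in> {1..n}. (if Legendre (gfib 0 b i) (int p) = 1 then 1 else 0) = j}"
proof -
  have "{e \<in> snd (star_graph (Suc n)). edge_label 0 b p (\<lambda>v. v) e = j} =
      (\<lambda>i. {0, i}) ` {i \<in> {1..n}. (if Legendre (gfib 0 b i) (int p) = 1 then 1 else 0) = j}"
    by (auto simp: star_graph_def edge_label_star_id)
  moreover have "inj_on (\<lambda>i::nat. {0, i}) S" for S
    by (auto simp: inj_on_def doubleton_eq_iff)
  ultimately show ?thesis
    by (simp add: edge_count_def card_image)
qed

theorem theorem3p2:
  fixes b :: int and p q :: nat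
  assumes "b \<noteq> 0"
    and "0 \<in> pisano_set 0 b"
    and "PL_prime 0 0 b p"
    and "q \<ge> 1"
  shows "FLC_graph 0 b p (star_graph (q * pisano_period 0 b p + 1))"
proof -
  let ?T = "pisano_period 0 b p"
  let ?L = "\<lambda>i. Legendre (gfib 0 b i) (int p)"
  let ?g = "\<lambda>i. if ?L i = 1 then 1 else - 1 :: int"
  let ?G = "star_graph (Suc (q * ?T))"
  from assms(3) have "p > 0" and balanced: "(\<Sum>i<?T. ?g i) = 0"
    by (auto simp: PL_prime_iff_sum prime_gt_0_nat)
  have "?L (n + ?T) = ?L n" for n
    using gfib_add_pisano_period[OF \<open>p > 0\<close>] by (rule Legendre_cong)
  hence "(\<Sum>i=1..q * ?T. ?g i) = int q * (\<Sum>i<?T. ?g i)"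
    by (intro sum_atLeast1_periodic) simp
  \<comment> \<open>The sign sum over the leaves is \<open>q\<close> times zero, so the two labels
    occur equally often and the difference bounded by 1 is in fact 0.\<close>
  hence "int (card {i \<in> {1..q * ?T}. ?L i = 1}) = int (card {i \<in> {1..q * ?T}. ?L i \<noteq> 1})"
    unfolding balanced by (subst (asm) sum_sign_eq_card_diff) auto
  moreover have "edge_count 0 b p ?G (\<lambda>v. v) 1 = card {i \<in> {1..q * ?T}. ?L i = 1}"
    unfolding edge_count_star_id by (rule arg_cong[of _ _ card]) auto
  moreover have "edge_count 0 b p ?G (\<lambda>v. v) 0 = card {i \<in> {1..q * ?T}. ?L i \<noteq> 1}"
    unfolding edge_count_star_id by (rule arg_cong[of _ _ card]) auto
  moreover have "bij_betw (\<lambda>v. v) (fst ?G) {0..<card (fst ?G)}"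
    by (simp add: star_graph_def bij_betw_def)
  ultimately have "FLC_labeling 0 b p ?G (\<lambda>v. v)"
    by (simp add: FLC_labeling_def)
  thus ?thesis
    using simple_star_graph connected_star_graph by (auto simp: FLC_graph_def)
qed

end
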